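(* Let $n, m \geq 1$ be integers, let $N_1, \dots, N_m$ be norms on $M(1)$ satisfying (i)--(v), let $h$ be a real-valued function of $m$ distance-matrix variables, and for all $k \geq 1$ and $X_1, \dots, X_m \in M(n \times k)$ put $$H(X_1, \dots, X_m) = h(D(N_1, X_1), \dots, D(N_m, X_m)).$$ Then the collection of limits of $H$ along strictly increasing sequences in $M(n)^{m=}$ is the topological closure (in $\mathbb{R}$) of the range of $H$.
   Context: $M(n \times k)$ is the set of real $n \times k$ matrices ($n,k\ge 1$), and $M(n) = \bigcup_{k \geq 1} M(n \times k)$; in particular $M(1)$ is the set of all real row vectors of any finite length. $0(n\times k)$ is the zero matrix in $M(n\times k)$. A norm on $M(1)$ is a function $N : M(1) \to \mathbb{R}$ such that for all $v, w \in M(1)$ and $c \in \mathbb{R}$: (i) $N(v) = 0$ if $v = 0(1\times k)$ for some $k$, and $N(v) > 0$ otherwise; (ii) $N(cv) = |c| N(v)$; (iii) $N(v+w) \leq N(v) + N(w)$ whenever $v$ and $w$ have the same number of columns. The norms considered are also assumed to satisfy: (iv) $N(v) = N(v')$ if $v$ is not a zero vector and $v'$ is obtained from $v$ by removing all its zero entries; (v) $N([1]) = 1$. For $X \in M(n \times k)$ with $i$-th row $x(i)$, the distance matrix $D(N,X)$ is the $n \times n$ matrix whose $(i,j)$ entry is $N(x(j) - x(i))$. The function $h$ is real-valued and defined on $\mathcal{D}_1 \times \cdots \times \mathcal{D}_m$, where $\mathcal{D}_i = \{D(N_i, X) : X \in M(n)\}$. $M(n)^{m=}$ is the set of $m$-tuples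 of members of $M(n)$ in which all $m$ entries have the same number of columns, i.e. $M(n)^{m=} = \bigcup_{k \geq 1} M(n\times k)^m$; this is the domain of $H$. A sequence in $M(n)^{m=}$ is strictly increasing if the common number of columns of each member of the sequence is strictly less than the common number of columns of the next member. A limit of $H$ along a strictly increasing sequence $(s_j)_{j \geq 1}$ is a real number $a$ with $a = \lim_{j \to \infty} H(s_j)$. The topological closure of the range of $H$ is the range together with the (real) limits of all convergent sequences of members of the range. *)

theory Defs
  imports "HOL-Analysis.Elementary_Topology" "Jordan_Normal_Form.Matrix"
begin

text \<open>Members of $M(1)$, the real row vectors of arbitrary length at least one, are the
  elements of \<^typ>\<open>real vec\<close> of positive dimension; this matches the library function
  \<^const>\<open>row\<close>, which returns a \<^typ>\<open>real vec\<close>. A norm is a total function, of which only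
  the values on vectors of positive dimension matter.\<close>

definition row_vectors :: "real vec set" where
  "row_vectors = (\<Union>k\<in>{1..}. carrier_vec k)"

definition remove_zeros :: "real vec \<Rightarrow> real vec" where
  "remove_zeros v = vec_of_list (filter (\<lambda>a. a \<noteq> 0) (list_of_vec v))"

definition norm_on_row_vectors :: "(real vec \<Rightarrow> real) \<Rightarrow> bool" where
  "norm_on_row_vectors N \<longleftrightarrow>
     (\<forall>k\<ge>1. N (0\<^sub>v k) = 0) \<and>
     (\<forall>v\<in>row_vectors. v \<noteq> 0\<^sub>v (dim_vec v) \<longrightarrow> N v > 0) \<and>
     (\<forall>v\<in>row_vectors. \<forall>c. N (c \<cdot>\<^sub>v v) = \<bar>c\<bar> * N v) \<and>
     (\<forall>v\<in>row_vectors. \<forall>w\<in>row_vectors. dim_vec v = dim_vec w \<longrightarrow> N (v + w) \<le> N v + N w) \<and>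
     (\<forall>v\<in>row_vectors. v \<noteq> 0\<^sub>v (dim_vec v) \<longrightarrow> N v = N (remove_zeros v)) \<and>
     N (vec_of_list [1]) = 1"

definition distance_matrix :: "(real vec \<Rightarrow> real) \<Rightarrow> real mat \<Rightarrow> real mat" where
  "distance_matrix N X =
     mat (dim_row X) (dim_row X) (\<lambda>(i, j). N (row X j - row X i))"

text \<open>Tuples are lists. \<open>equal_col_tuples n m\<close> is $M(n)^{m=}$.\<close>

definition equal_col_tuples :: "nat \<Rightarrow> nat \<Rightarrow> real mat list set" where
  "equal_col_tuples n m =
     (\<Union>k\<in>{1..}. {Xs. length Xs = m \<and> set Xs \<subseteq> carrier_mat n k})"

text \<open>The common number of columns, for a nonempty tuple in \<^const>\<open>equal_col_tuples\<close>.\<close>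

definition num_cols :: "real mat list \<Rightarrow> nat" where
  "num_cols Xs = dim_col (hd Xs)"

definition strictly_increasing_seq :: "nat \<Rightarrow> nat \<Rightarrow> (nat \<Rightarrow> real mat list) \<Rightarrow> bool" where
  "strictly_increasing_seq n m s \<longleftrightarrow>
     (\<forall>j. s j \<in> equal_col_tuples n m) \<and> (\<forall>j. num_cols (s j) < num_cols (s (Suc j)))"

text \<open>\<open>h\<close> is a total function, but in \<open>H_fun\<close> it is only applied to tuples of distance matrices
  when the argument is in \<^term>\<open>equal_col_tuples n (length Ns)\<close>.\<close>

definition H_fun :: "(real vec \<Rightarrow> real) list \<Rightarrow> (real mat list \<Rightarrow> real) \<Rightarrow> real mat list \<Rightarrow> real" where
  "H_fun Ns h Xs = h (map2 distance_matrix Ns Xs)"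

definition limits_along_increasing ::
  "nat \<Rightarrow> nat \<Rightarrow> (real mat list \<Rightarrow> real) \<Rightarrow> real set" where
  "limits_along_increasing n m H =
     {a. \<exists>s. strictly_increasing_seq n m s \<and> (\<lambda>j. H (s j)) \<longlonglongrightarrow> a}"

end

theory Submission
  imports Defs
begin

text \<open>Appending zero columns to a matrix does not change its distance matrix: the difference of two
  rows is either zero before and after, or nonzero, and then the norms see only its nonzero entries,
  in order (\<open>distance_matrix_append_zero_cols\<close>). Hence every value of \<open>H\<close> at a tuple with \<open>k\<close> columns is
  also a value of \<open>H\<close> at a tuple with any larger number of columns. A point of the closure is the
  limit of values of \<open>H\<close> at some sequence of tuples, and zero columns turn this sequence into a
  strictly increasing one with the same values. The converse inclusion only says that limits of
  values lie in the closure of the range.\<close>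

lemma remove_zeros_append_zero_vec: "remove_zeros (v @\<^sub>v 0\<^sub>v c) = remove_zeros v"
proof -
  have "list_of_vec (v @\<^sub>v 0\<^sub>v c) = list_of_vec v @ replicate c (0::real)"
    by (simp only: list_of_vec_append list_of_vec_0)
  then show ?thesis
    by (simp add: remove_zeros_def)
qed

lemma row_vectors_iff: "v \<in> row_vectors \<longleftrightarrow> dim_vec v \<ge> 1"
  unfolding row_vectors_def carrier_vec_def by simp

lemma norm_append_zero_vec:
  assumes N: "norm_on_row_vectors N" and v: "v \<in> row_vectors"
  shows "N (v @\<^sub>v 0\<^sub>v c) = N v"
proof -
  let ?v = "v @\<^sub>v 0\<^sub>v c"
  from v have dim: "dim_vec v \<ge> 1" and v': "?v \<in> row_vectors"
    by (simp_all add: row_vectors_iff)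
  have zero_iff: "?v = 0\<^sub>v (dim_vec ?v) \<longleftrightarrow> v = 0\<^sub>v (dim_vec v)"
  proof
    assume zero: "?v = 0\<^sub>v (dim_vec ?v)"
    have "v $ i = 0" if "i < dim_vec v" for i
      using arg_cong[OF zero, of "\<lambda>u. u $ i"] that by simp
    then show "v = 0\<^sub>v (dim_vec v)"
      by (intro eq_vecI) auto
  next
    assume zero: "v = 0\<^sub>v (dim_vec v)"
    have "v $ i = 0" if "i < dim_vec v" for i
      using arg_cong[OF zero, of "\<lambda>u. u $ i"] that by simp
    then show "?v = 0\<^sub>v (dim_vec ?v)"
      by (intro eq_vecI) auto
  qed
  show ?thesis
  proof (cases "v = 0\<^sub>v (dim_vec v)")
    case True
    have null: "N w = 0" if "w = 0\<^sub>v (dim_vec w)" "dim_vec w \<ge> 1" for w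
      by (subst that(1)) (use N that(2) in \<open>simp only: norm_on_row_vectors_def\<close>)
    have "dim_vec ?v \<ge> 1" using dim by simp
    moreover from True zero_iff have "?v = 0\<^sub>v (dim_vec ?v)" by blast
    ultimately have "N ?v = 0" by (intro null)
    with null[OF True dim] show ?thesis by (simp only:)
  next
    case False
    have "N w = N (remove_zeros w)" if "w \<in> row_vectors" "w \<noteq> 0\<^sub>v (dim_vec w)" for w
      using N that by (simp add: norm_on_row_vectors_def)
    moreover from False zero_iff have "?v \<noteq> 0\<^sub>v (dim_vec ?v)" by blast
    ultimately have "N v = N (remove_zeros v)" "N ?v = N (remove_zeros ?v)"
      using v v' False by blast+
    then show ?thesis
      by (simp only: remove_zeros_append_zero_vec)
  qed
qed

definition append_zero_cols :: "nat \<Rightarrow> real mat \<Rightarrow> real mat" where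
  "append_zero_cols c X =
     mat (dim_row X) (dim_col X + c) (\<lambda>(i, j). if j < dim_col X then X $$ (i, j) else 0)"

lemma row_append_zero_cols:
  "i < dim_row X \<Longrightarrow> row (append_zero_cols c X) i = row X i @\<^sub>v 0\<^sub>v c"
  by (intro eq_vecI) (auto simp: append_zero_cols_def)

lemma distance_matrix_append_zero_cols:
  assumes "norm_on_row_vectors N" and "dim_col X \<ge> 1"
  shows "distance_matrix N (append_zero_cols c X) = distance_matrix N X"
proof -
  have "N (row (append_zero_cols c X) j - row (append_zero_cols c X) i) = N (row X j - row X i)"
    if "i < dim_row X" "j < dim_row X" for i j
  proof -
    have "(row X j @\<^sub>v 0\<^sub>v c) - (row X i @\<^sub>v 0\<^sub>v c) = (row X j - row X i) @\<^sub>v 0\<^sub>v c"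
      by (intro eq_vecI) auto
    moreover have "row X j - row X i \<in> row_vectors"
      using assms(2) by (simp add: row_vectors_iff)
    ultimately show ?thesis
      using that assms(1) by (simp add: row_append_zero_cols norm_append_zero_vec)
  qed
  then show ?thesis
    by (intro eq_matI) (auto simp: distance_matrix_def append_zero_cols_def)
qed

lemma H_fun_append_zero_cols:
  assumes "\<And>N. N \<in> set Ns \<Longrightarrow> norm_on_row_vectors N"
    and "Xs \<in> equal_col_tuples n m"
  shows "H_fun Ns h (map (append_zero_cols c) Xs) = H_fun Ns h Xs"
proof -
  have "dim_col X \<ge> 1" if "X \<in> set Xs" for X
    using assms(2) that by (auto simp: equal_col_tuples_def)
  then have "map2 distance_matrix Ns (map (append_zero_cols c) Xs) = map2 distance_matrix Ns Xs"
    using assms(1)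
    by (intro nth_equalityI) (auto simp: distance_matrix_append_zero_cols)
  then show ?thesis
    by (simp only: H_fun_def)
qed

lemma append_zero_cols_in_equal_col_tuples:
  assumes "Xs \<in> equal_col_tuples n m"
  shows "map (append_zero_cols c) Xs \<in> equal_col_tuples n m"
proof -
  from assms obtain k where k: "k \<ge> 1" "length Xs = m" "set Xs \<subseteq> carrier_mat n k"
    by (auto simp: equal_col_tuples_def)
  then have "set (map (append_zero_cols c) Xs) \<subseteq> carrier_mat n (k + c)"
    by (auto simp: append_zero_cols_def)
  then show ?thesis
    using k by (auto simp: equal_col_tuples_def intro!: bexI[of _ "k + c"])
qed

lemma num_cols_append_zero_cols:
  assumes "Xs \<noteq> []"
  shows "num_cols (map (append_zero_cols c) Xs) = num_cols Xs + c"
  using assms by (simp add: num_cols_def hd_map append_zero_cols_def)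

lemma num_cols_pos:
  assumes "Xs \<in> equal_col_tuples n m" and "m \<ge> 1"
  shows "num_cols Xs \<ge> 1"
proof -
  from assms have "hd Xs \<in> set Xs"
    by (intro hd_in_set) (auto simp: equal_col_tuples_def)
  with assms(1) show ?thesis
    by (auto simp: equal_col_tuples_def num_cols_def)
qed

theorem mainTheorem2:
  fixes n m :: nat
    and Ns :: "(real vec \<Rightarrow> real) list"
    and h :: "real mat list \<Rightarrow> real"
  assumes "n \<ge> 1" and "m \<ge> 1"
    and "length Ns = m"
    and "\<And>N. N \<in> set Ns \<Longrightarrow> norm_on_row_vectors N"
  shows "limits_along_increasing n m (H_fun Ns h) =
         closure (H_fun Ns h ` equal_col_tuples n m)"
proof
  let ?H = "H_fun Ns h"
  show "limits_along_increasing n m ?H \<subseteq> closure (?H ` equal_col_tuples n m)"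
  proof
    fix a assume "a \<in> limits_along_increasing n m ?H"
    then obtain s where "\<And>j. s j \<in> equal_col_tuples n m" and lim: "(\<lambda>j. ?H (s j)) \<longlonglongrightarrow> a"
      by (auto simp: limits_along_increasing_def strictly_increasing_seq_def)
    then have "\<forall>j. ?H (s j) \<in> ?H ` equal_col_tuples n m"
      by simp
    with lim show "a \<in> closure (?H ` equal_col_tuples n m)"
      unfolding closure_sequential by (intro exI[of _ "\<lambda>j. ?H (s j)"] conjI)
  qed
  show "closure (?H ` equal_col_tuples n m) \<subseteq> limits_along_increasing n m ?H"
  proof
    fix a assume "a \<in> closure (?H ` equal_col_tuples n m)"
    then obtain x where x: "\<And>j. x j \<in> ?H ` equal_col_tuples n m" and lim: "x \<longlonglongrightarrow> a"
      unfolding closure_sequential by blast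
    from x have "\<forall>j. \<exists>Xs. Xs \<in> equal_col_tuples n m \<and> x j = ?H Xs" by blast
    then obtain t where t: "\<And>j. t j \<in> equal_col_tuples n m" and xt: "\<And>j. x j = ?H (t j)"
      by metis
    \<comment> \<open>The tuple \<open>s j\<close> has as many columns as \<open>t 0, \<dots>, t j\<close> together, and each of these has at least
      one column.\<close>
    define s where "s j = map (append_zero_cols (\<Sum>i<j. num_cols (t i))) (t j)" for j
    have ne: "t j \<noteq> []" for j
      using t[of j] assms(2) by (auto simp: equal_col_tuples_def)
    have "num_cols (s j) < num_cols (s (Suc j))" for j
      using num_cols_pos[OF t[of "Suc j"] assms(2)]
      by (simp add: s_def num_cols_append_zero_cols[OF ne])
    then have "strictly_increasing_seq n m s"
      using append_zero_cols_in_equal_col_tuples[OF t]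
      by (simp add: strictly_increasing_seq_def s_def)
    moreover have "(\<lambda>j. ?H (s j)) = x"
      using H_fun_append_zero_cols[OF assms(4) t] by (simp add: s_def xt fun_eq_iff)
    ultimately show "a \<in> limits_along_increasing n m ?H"
      using lim unfolding limits_along_increasing_def by auto
  qed
qed

end
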